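(* Let $d\ge2$ and let $(\mathcal H,\mathsf S)$, $\mathsf S=(S_1,\dots,S_{d-1},P)$, be a contractive Hilbert module. Let $\mathfrak J:\mathcal H\to\mathcal K$ be a canonical embedding of $(\mathcal H,\mathsf S)$ as a submodule of a unitary Hilbert module $(\mathcal K,\mathsf R)$. Let $X$ be in the commutant of $\mathsf S$. Then the module $(\mathcal H,X)$ can be contractively embedded as a submodule of $(\mathcal K,Y)$ for some $Y$ in the commutant of $\mathsf R$ with $\|Y\|\le\|X\|$.
   Context: Fix $d\ge2$. All Hilbert spaces are complex and all operators are bounded and linear. Let $e_k(z_1,\dots,z_d)=\sum_{1\le j_1<\cdots<j_k\le d}z_{j_1}\cdots z_{j_k}$. The closed symmetrized polydisc is $\Gamma_d=\{(e_1(\boldsymbol z),\dots,e_d(\boldsymbol z)):\boldsymbol z\in\overline{\mathbb D}^d\}\subset\mathbb C^d$, with points written $(s_1,\dots,s_{d-1},p)$; its distinguished boundary is $b\Gamma_d=\{(s_1,\dots,s_{d-1},p)\in\Gamma_d:|p|=1\}$. For a commuting $d$-tuple $\mathsf S=(S_1,\dots,S_{d-1},P)$ of bounded operators on $\mathcal H$, regard $\mathcal H$ as a module over $\mathcal A=\mathbb C[z_1,\dots,z_d]$ by $f\cdot h=f(S_1,\dots,S_{d-1},P)h$; denote it $(\mathcal H,\mathsf S)$. It is a contractive Hilbert module if $\|f(\mathsf S)h\|\le\big(\sup_{\Gamma_d}|f|\big)\|h\|$ for all $f\in\mathcal A$, $h\in\mathcal H$. A contractive Hilbert module $(\mathcal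 K,\mathsf R)$, $\mathsf R=(R_1,\dots,R_{d-1},U)$, is a unitary Hilbert module if all entries of $\mathsf R$ are normal and the Taylor joint spectrum of $\mathsf R$ is contained in $b\Gamma_d$. A module map from $(\mathcal H,\mathsf S)$ to $(\mathcal K,\mathsf R)$ is a bounded operator $L:\mathcal H\to\mathcal K$ with $L(f\cdot h)=f\cdot Lh$ for all $f\in\mathcal A$, $h\in\mathcal H$. If there is a module map that is a contraction, one says that $(\mathcal H,\mathsf S)$ is contractively embedded as a submodule of $(\mathcal K,\mathsf R)$. A contractive module map $\mathfrak J:\mathcal H\to\mathcal K$ is canonical (a canonical embedding) if no proper closed subspace of $\mathcal K$ contains $\mathfrak J\mathcal H$ and reduces $\mathsf R$, and $\mathfrak J^*\mathfrak J=\operatorname{SOT-}\lim_n P^{*n}P^n$. For a single bounded operator $X$ on $\mathcal H$, $(\mathcal H,X)$ denotes $\mathcal H$ viewed as a $\mathbb C[z]$-module via $f\cdot h=f(X)h$; module maps and contractive embeddings between such modules are defined in the same way. *)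

theory Defs
  imports "HOL-Analysis.Analysis" "HOL-Library.Poly_Mapping"
begin

text \<open>
  Complex Hilbert spaces. The inner product is linear in the first argument; its real part is the
  library's real inner product, which fixes the norm and hence positivity and the topology.
\<close>

class chilbert_space = real_inner + complete_space +
  fixes scaleC :: "complex \<Rightarrow> 'a \<Rightarrow> 'a"
    and cinner :: "'a \<Rightarrow> 'a \<Rightarrow> complex"
  assumes scaleC_of_real: "scaleC (complex_of_real r) x = r *\<^sub>R x"
    and scaleC_add_right: "scaleC a (x + y) = scaleC a x + scaleC a y"
    and scaleC_add_left: "scaleC (a + b) x = scaleC a x + scaleC b x"
    and scaleC_scaleC: "scaleC a (scaleC b x) = scaleC (a * b) x"
    and cinner_commute: "cinner x y = cnj (cinner y x)"
    and cinner_add_left: "cinner (x + y) z = cinner x z + cinner y z"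
    and cinner_scaleC_left: "cinner (scaleC a x) y = a * cinner x y"
    and Re_cinner: "Re (cinner x y) = inner x y"

instantiation complex :: chilbert_space
begin
definition scaleC_complex :: "complex \<Rightarrow> complex \<Rightarrow> complex" where
  "scaleC_complex a x = a * x"
definition cinner_complex :: "complex \<Rightarrow> complex \<Rightarrow> complex" where
  "cinner_complex x y = x * cnj y"
instance
  by standard
    (auto simp: scaleC_complex_def cinner_complex_def algebra_simps inner_complex_def
      scaleR_conv_of_real)
end

definition bounded_clinear :: "('a::chilbert_space \<Rightarrow> 'b::chilbert_space) \<Rightarrow> bool" where
  "bounded_clinear T \<longleftrightarrow> bounded_linear T \<and> (\<forall>c x. T (scaleC c x) = scaleC c (T x))"

definition closed_csubspace :: "'a::chilbert_space set \<Rightarrow> bool" where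
  "closed_csubspace M \<longleftrightarrow>
     closed M \<and> 0 \<in> M \<and> (\<forall>x\<in>M. \<forall>y\<in>M. x + y \<in> M) \<and> (\<forall>c. \<forall>x\<in>M. scaleC c x \<in> M)"

text \<open>The description is proper for bounded operators, by Riesz representation.\<close>

definition cadjoint :: "('a::chilbert_space \<Rightarrow> 'b::chilbert_space) \<Rightarrow> 'b \<Rightarrow> 'a" where
  "cadjoint T = (THE T'. \<forall>x y. cinner (T x) y = cinner x (T' y))"

definition normal_op :: "('a::chilbert_space \<Rightarrow> 'a) \<Rightarrow> bool" where
  "normal_op T \<longleftrightarrow> T \<circ> cadjoint T = cadjoint T \<circ> T"

text \<open>
  Coordinates, variables and operator tuples of length \<open>d\<close> are functions on \<open>nat\<close> of which only the
  values on \<open>{1..d}\<close> matter; the last coordinate \<open>p\<close> of a point and the last operator \<open>P\<close> (or \<open>U\<close>)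
  of a tuple are those at index \<open>d\<close>. A point of \<open>\<complex>\<^sup>d\<close> is an element of \<open>{1..d} \<rightarrow>\<^sub>E UNIV\<close>.
\<close>

definition elem_sym :: "nat \<Rightarrow> nat \<Rightarrow> (nat \<Rightarrow> complex) \<Rightarrow> complex" where
  "elem_sym d k z = (\<Sum>I | I \<subseteq> {1..d} \<and> card I = k. \<Prod>j\<in>I. z j)"

definition sym_polydisc :: "nat \<Rightarrow> (nat \<Rightarrow> complex) set" where
  "sym_polydisc d =
     {restrict (\<lambda>k. elem_sym d k z) {1..d} | z. \<forall>j\<in>{1..d}. cmod (z j) \<le> 1}"

definition sym_polydisc_boundary :: "nat \<Rightarrow> (nat \<Rightarrow> complex) set" where
  "sym_polydisc_boundary d = {s \<in> sym_polydisc d. cmod (s d) = 1}"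

text \<open>
  A polynomial is a finitely supported map from exponents (finitely supported maps from variables
  to \<open>nat\<close>) to coefficients; \<open>poly_ring d\<close> is \<open>\<complex>[z\<^sub>1, \<dots>, z\<^sub>d]\<close>.
\<close>

definition poly_ring :: "nat \<Rightarrow> ((nat \<Rightarrow>\<^sub>0 nat) \<Rightarrow>\<^sub>0 complex) set" where
  "poly_ring d = {f. \<forall>m\<in>Poly_Mapping.keys f. Poly_Mapping.keys m \<subseteq> {1..d}}"

definition poly_eval :: "nat \<Rightarrow> ((nat \<Rightarrow>\<^sub>0 nat) \<Rightarrow>\<^sub>0 complex) \<Rightarrow> (nat \<Rightarrow> complex) \<Rightarrow> complex" where
  "poly_eval d f z =
     (\<Sum>m\<in>Poly_Mapping.keys f.
        Poly_Mapping.lookup f m * (\<Prod>i\<in>{1..d}. z i ^ Poly_Mapping.lookup m i))"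

text \<open>
  The factors of a monomial are composed in the order of the indices; for commuting tuples the
  order is immaterial.
\<close>

definition monom_op :: "nat \<Rightarrow> (nat \<Rightarrow>\<^sub>0 nat) \<Rightarrow> (nat \<Rightarrow> 'a \<Rightarrow> 'a) \<Rightarrow> 'a \<Rightarrow> 'a" where
  "monom_op d m T = foldr (\<lambda>i A. (T i ^^ Poly_Mapping.lookup m i) \<circ> A) [1..<Suc d] id"

definition poly_op ::
  "nat \<Rightarrow> ((nat \<Rightarrow>\<^sub>0 nat) \<Rightarrow>\<^sub>0 complex) \<Rightarrow> (nat \<Rightarrow> 'a::chilbert_space \<Rightarrow> 'a) \<Rightarrow> 'a \<Rightarrow> 'a" where
  "poly_op d f T h =
     (\<Sum>m\<in>Poly_Mapping.keys f. scaleC (Poly_Mapping.lookup f m) (monom_op d m T h))"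

definition commuting_tuple :: "nat \<Rightarrow> (nat \<Rightarrow> 'a::chilbert_space \<Rightarrow> 'a) \<Rightarrow> bool" where
  "commuting_tuple d T \<longleftrightarrow>
     (\<forall>i\<in>{1..d}. bounded_clinear (T i)) \<and> (\<forall>i\<in>{1..d}. \<forall>j\<in>{1..d}. T i \<circ> T j = T j \<circ> T i)"

definition commutant :: "nat \<Rightarrow> (nat \<Rightarrow> 'a::chilbert_space \<Rightarrow> 'a) \<Rightarrow> ('a \<Rightarrow> 'a) set" where
  "commutant d T = {X. bounded_clinear X \<and> (\<forall>i\<in>{1..d}. X \<circ> T i = T i \<circ> X)}"

text \<open>
  The Taylor joint spectrum via the Koszul complex: an element of \<open>H \<otimes> \<Lambda>(\<complex>\<^sup>d)\<close>, written
  \<open>\<Sum>I. x I \<otimes> e\<^sub>I\<close> with \<open>e\<^sub>I\<close> the wedge of the basis vectors \<open>e\<^sub>i\<close>, \<open>i \<in> I\<close>, in increasing order, is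
  the function \<open>x\<close> on the subsets \<open>I\<close> of \<open>{1..d}\<close>. The differential is
  \<open>x \<otimes> e\<^sub>I \<mapsto> \<Sum>i. T\<^sub>i x \<otimes> (e\<^sub>i \<and> e\<^sub>I)\<close>. As it is homogeneous of degree 1, exactness at all degrees
  (including both ends) means that kernel and image agree on the total space.
\<close>

definition koszul_space :: "nat \<Rightarrow> (nat set \<Rightarrow> 'a::chilbert_space) set" where
  "koszul_space d = {x. \<forall>I. \<not> I \<subseteq> {1..d} \<longrightarrow> x I = 0}"

definition koszul_diff ::
  "nat \<Rightarrow> (nat \<Rightarrow> 'a::chilbert_space \<Rightarrow> 'a) \<Rightarrow> (nat set \<Rightarrow> 'a) \<Rightarrow> nat set \<Rightarrow> 'a" where
  "koszul_diff d T x I =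
     (if I \<subseteq> {1..d} then \<Sum>i\<in>I. (- 1) ^ card {j \<in> I. j < i} *\<^sub>R T i (x (I - {i})) else 0)"

definition koszul_exact :: "nat \<Rightarrow> (nat \<Rightarrow> 'a::chilbert_space \<Rightarrow> 'a) \<Rightarrow> bool" where
  "koszul_exact d T \<longleftrightarrow>
     {x \<in> koszul_space d. koszul_diff d T x = (\<lambda>_. 0)} = koszul_diff d T ` koszul_space d"

definition taylor_spectrum :: "nat \<Rightarrow> (nat \<Rightarrow> 'a::chilbert_space \<Rightarrow> 'a) \<Rightarrow> (nat \<Rightarrow> complex) set" where
  "taylor_spectrum d T =
     {l \<in> {1..d} \<rightarrow>\<^sub>E UNIV. \<not> koszul_exact d (\<lambda>i h. T i h - scaleC (l i) h)}"

definition contractive_hilbert_module :: "nat \<Rightarrow> (nat \<Rightarrow> 'a::chilbert_space \<Rightarrow> 'a) \<Rightarrow> bool" where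
  "contractive_hilbert_module d S \<longleftrightarrow>
     commuting_tuple d S \<and>
     (\<forall>f\<in>poly_ring d. \<forall>h.
        norm (poly_op d f S h) \<le> (SUP z\<in>sym_polydisc d. cmod (poly_eval d f z)) * norm h)"

definition unitary_hilbert_module :: "nat \<Rightarrow> (nat \<Rightarrow> 'a::chilbert_space \<Rightarrow> 'a) \<Rightarrow> bool" where
  "unitary_hilbert_module d R \<longleftrightarrow>
     contractive_hilbert_module d R \<and>
     (\<forall>i\<in>{1..d}. normal_op (R i)) \<and>
     taylor_spectrum d R \<subseteq> sym_polydisc_boundary d"

definition module_map ::
  "nat \<Rightarrow> (nat \<Rightarrow> 'a::chilbert_space \<Rightarrow> 'a) \<Rightarrow> (nat \<Rightarrow> 'b::chilbert_space \<Rightarrow> 'b) \<Rightarrow> ('a \<Rightarrow> 'b) \<Rightarrow> bool"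
  where
  "module_map d S R L \<longleftrightarrow>
     bounded_clinear L \<and> (\<forall>f\<in>poly_ring d. \<forall>h. L (poly_op d f S h) = poly_op d f R (L h))"

definition contractive_module_map ::
  "nat \<Rightarrow> (nat \<Rightarrow> 'a::chilbert_space \<Rightarrow> 'a) \<Rightarrow> (nat \<Rightarrow> 'b::chilbert_space \<Rightarrow> 'b) \<Rightarrow> ('a \<Rightarrow> 'b) \<Rightarrow> bool"
  where
  "contractive_module_map d S R L \<longleftrightarrow> module_map d S R L \<and> onorm L \<le> 1"

text \<open>
  Nothing here excludes the zero map, so that a statement about the embedding of a lift has to name
  the module map in question. A single operator is a tuple of length 1.
\<close>

definition contractively_embedded ::
  "nat \<Rightarrow> (nat \<Rightarrow> 'a::chilbert_space \<Rightarrow> 'a) \<Rightarrow> (nat \<Rightarrow> 'b::chilbert_space \<Rightarrow> 'b) \<Rightarrow> bool" where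
  "contractively_embedded d S R \<longleftrightarrow> (\<exists>L. contractive_module_map d S R L)"

definition reduces :: "nat \<Rightarrow> (nat \<Rightarrow> 'a::chilbert_space \<Rightarrow> 'a) \<Rightarrow> 'a set \<Rightarrow> bool" where
  "reduces d R M \<longleftrightarrow> (\<forall>i\<in>{1..d}. R i ` M \<subseteq> M \<and> cadjoint (R i) ` M \<subseteq> M)"

definition canonical_embedding ::
  "nat \<Rightarrow> (nat \<Rightarrow> 'a::chilbert_space \<Rightarrow> 'a) \<Rightarrow> (nat \<Rightarrow> 'b::chilbert_space \<Rightarrow> 'b) \<Rightarrow> ('a \<Rightarrow> 'b) \<Rightarrow> bool"
  where
  "canonical_embedding d S R J \<longleftrightarrow>
     contractive_module_map d S R J \<and>
     (\<forall>M. closed_csubspace M \<and> range J \<subseteq> M \<and> reduces d R M \<longrightarrow> M = UNIV) \<and>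
     (\<forall>h. (\<lambda>n. (cadjoint (S d) ^^ n) ((S d ^^ n) h)) \<longlonglongrightarrow> cadjoint J (J h))"

end

theory Submission
  imports Defs "HOL-Complex_Analysis.Conformal_Mappings"
begin

text \<open>The last operator \<open>U\<close> of the unitary module is a normal contraction, and it is isometric on the range
  of \<open>J\<close> because \<open>J\<^sup>* J = lim P\<^sup>*\<^sup>n P\<^sup>n\<close>. The set where \<open>U\<^sup>* U\<close> is the identity reduces the module, hence by
  minimality \<open>U\<close> is unitary. Contractivity over the symmetrized polydisc then gives
  \<open>R\<^sub>i\<^sup>* = U\<^sup>* R\<^bsub>d-i\<^esub>\<close>, so that the increasing union of the spaces \<open>U\<^sup>*\<^sup>n J H\<close> is invariant under all \<open>R\<^sub>i\<close> and
  \<open>R\<^sub>i\<^sup>*\<close> and therefore dense. On it \<open>Y\<close> is given by \<open>U\<^sup>*\<^sup>n J h \<mapsto> U\<^sup>*\<^sup>n J X h\<close>, which is bounded by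
  \<open>\<parallel>X\<parallel>\<close> since \<open>\<parallel>J X h\<parallel> = lim \<parallel>X P\<^sup>n h\<parallel>\<close>.\<close>

section \<open>Hilbert spaces and adjoints\<close>

lemma scaleC_zero_right [simp]: "scaleC c (0::'a::chilbert_space) = 0"
  using scaleC_add_right[of c "0::'a" 0] by simp

lemma scaleC_zero_left [simp]: "scaleC 0 (x::'a::chilbert_space) = 0"
  using scaleC_of_real[of 0 x] by simp

lemma scaleC_one [simp]: "scaleC 1 (x::'a::chilbert_space) = x"
  using scaleC_of_real[of 1 x] by simp

lemma scaleC_minus_left: "scaleC (- c) (x::'a::chilbert_space) = - scaleC c x"
  using scaleC_scaleC[of "-1" c x] scaleC_of_real[of "-1" "scaleC c x"] by simp

lemma scaleC_diff_right: "scaleC c (x - y::'a::chilbert_space) = scaleC c x - scaleC c y"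
  using scaleC_add_right[of c "x - y" y] by (simp add: eq_diff_eq)

lemma cinner_add_right: "cinner (x::'a::chilbert_space) (y + z) = cinner x y + cinner x z"
  by (metis cinner_add_left cinner_commute complex_cnj_add)

lemma cinner_scaleC_right: "cinner (x::'a::chilbert_space) (scaleC c y) = cnj c * cinner x y"
  by (metis cinner_scaleC_left cinner_commute complex_cnj_mult)

lemma cinner_diff_left: "cinner (x - y::'a::chilbert_space) z = cinner x z - cinner y z"
  using cinner_add_left[of "x - y" y z] by (simp add: eq_diff_eq)

lemma cinner_diff_right: "cinner (x::'a::chilbert_space) (y - z) = cinner x y - cinner x z"
  using cinner_add_right[of x "y - z" z] by (simp add: eq_diff_eq)

lemma cinner_self: "cinner (x::'a::chilbert_space) x = complex_of_real ((norm x)\<^sup>2)"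
proof -
  have "Im (cinner x x) = 0"
    using arg_cong[OF cinner_commute[of x x], of Im] by simp
  then show ?thesis
    by (simp add: complex_eq_iff Re_cinner power2_norm_eq_inner)
qed

lemma Im_cinner: "Im (cinner (x::'a::chilbert_space) y) = inner (scaleC (- \<i>) x) y"
  using Re_cinner[of "scaleC (- \<i>) x" y] by (simp add: cinner_scaleC_left)

lemma cinner_eqI:
  fixes y z :: "'a::chilbert_space"
  assumes "\<And>x. cinner x y = cinner x z"
  shows "y = z"
proof -
  have "cinner (y - z) (y - z) = 0"
    using assms by (simp add: cinner_diff_right)
  then show ?thesis
    by (simp add: cinner_self)
qed

text \<open>Polarization: expanding at \<open>u + v\<close> shows that
  \<open>cinner (T u) v + cinner (T v) u\<close> vanishes. Replacing \<open>v\<close> by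
  \<open>scaleC \<i> v\<close> changes the relative sign of the two terms, so each vanishes
  separately.\<close>

lemma cinner_polarization_zero:
  fixes T :: "'a::chilbert_space \<Rightarrow> 'a"
  assumes T: "bounded_clinear T" and zero: "\<And>h. cinner (T h) h = 0"
  shows "T x = 0"
proof -
  have add: "T (u + v) = T u + T v" and sc: "T (scaleC c u) = scaleC c (T u)" for u v c
    using T by (auto simp: bounded_clinear_def linear_simps)
  have sym: "cinner (T u) v + cinner (T v) u = 0" for u v
    using zero[of "u + v"] zero[of u] zero[of v] by (simp add: add cinner_add_left cinner_add_right add.commute)
  have "cinner (T x) v = 0" for v
    using sym[of x v] sym[of x "scaleC \<i> v"]
    by (simp add: sc cinner_scaleC_left cinner_scaleC_right complex_eq_iff)
  then have "cinner (T x) (T x) = 0" .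
  then show ?thesis by (simp add: cinner_self)
qed

lemma norm_scaleC: "norm (scaleC c (x::'a::chilbert_space)) = cmod c * norm x"
proof -
  have "complex_of_real ((norm (scaleC c x))\<^sup>2) = complex_of_real ((cmod c * norm x)\<^sup>2)"
    by (simp only: cinner_self[symmetric] cinner_scaleC_left cinner_scaleC_right)
       (simp add: cinner_self power_mult_distrib mult_ac flip: complex_norm_square)
  then have "(norm (scaleC c x))\<^sup>2 = (cmod c * norm x)\<^sup>2"
    by (simp only: of_real_eq_iff)
  then show ?thesis by (simp add: power2_eq_iff_nonneg)
qed

lemma bounded_linear_scaleC: "bounded_linear (scaleC c :: 'a::chilbert_space \<Rightarrow> 'a)"
proof (rule bounded_linear_intro)
  show "scaleC c (r *\<^sub>R x) = r *\<^sub>R scaleC c x" for r and x :: 'a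
    by (simp add: scaleC_of_real[symmetric] scaleC_scaleC mult.commute)
  show "norm (scaleC c x) \<le> norm x * cmod c" for x :: 'a
    by (simp add: norm_scaleC mult.commute)
qed (rule scaleC_add_right)

lemma bounded_clinear_iff:
  fixes T :: "'a::chilbert_space \<Rightarrow> 'b::chilbert_space"
  shows "bounded_clinear T \<longleftrightarrow> (\<forall>x y. T (x + y) = T x + T y) \<and>
    (\<forall>c x. T (scaleC c x) = scaleC c (T x)) \<and> (\<exists>B. \<forall>x. norm (T x) \<le> B * norm x)"
proof
  assume "bounded_clinear T"
  then show "(\<forall>x y. T (x + y) = T x + T y) \<and>
    (\<forall>c x. T (scaleC c x) = scaleC c (T x)) \<and> (\<exists>B. \<forall>x. norm (T x) \<le> B * norm x)"
    by (auto simp: bounded_clinear_def linear_simps intro!: exI[of _ "onorm T"] onorm)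
next
  assume *: "(\<forall>x y. T (x + y) = T x + T y) \<and>
    (\<forall>c x. T (scaleC c x) = scaleC c (T x)) \<and> (\<exists>B. \<forall>x. norm (T x) \<le> B * norm x)"
  then obtain B where "norm (T x) \<le> B * norm x" for x by blast
  with * have "bounded_linear T"
    by (intro bounded_linear_intro[where K = B])
       (simp_all add: scaleC_of_real[symmetric] mult.commute)
  with * show "bounded_clinear T" by (simp add: bounded_clinear_def)
qed

lemma bounded_clinearD:
  assumes "bounded_clinear T"
  shows "bounded_linear T" "T (x + y) = T x + T y" "T (x - y) = T x - T y"
    "T (scaleC c x) = scaleC c (T x)" "T 0 = 0" "T (sum g A) = (\<Sum>a\<in>A. T (g a))"
    "norm (T x) \<le> onorm T * norm x"
  using assms
  by (auto simp: bounded_clinear_def linear_simps intro: onorm linear_sum bounded_linear.linear)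

lemma bounded_clinear_compose:
  "bounded_clinear S \<Longrightarrow> bounded_clinear T \<Longrightarrow> bounded_clinear (\<lambda>x. S (T x))"
  unfolding bounded_clinear_def using bounded_linear_compose[of S T] by auto

lemma bounded_clinear_diff:
  "bounded_clinear S \<Longrightarrow> bounded_clinear T \<Longrightarrow> bounded_clinear (\<lambda>x. S x - T x)"
  unfolding bounded_clinear_def using bounded_linear_sub[of S T] by (auto simp: scaleC_diff_right)

text \<open>The first-variation argument, used for the minimizer in the Riesz representation and for
  expansions in a small parameter of contractivity inequalities.\<close>

lemma linear_coefficient_zero:
  fixes a b :: real
  assumes "\<And>t. 0 \<le> a * t\<^sup>2 + 2 * t * b"
  shows "b = 0"
proof (rule ccontr)
  assume "b \<noteq> 0"
  \<comment> \<open>This choice makes \<open>c\<close> positive and larger than \<open>a\<close>, so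
    at \<open>t = - b / c\<close> the factor \<open>a - 2 * c\<close> is negative.\<close>
  define c where "c = \<bar>a\<bar> + 1"
  have "c > 0" "a < c" by (simp_all add: c_def)
  have "0 \<le> a * (- b / c)\<^sup>2 + 2 * (- b / c) * b" by (rule assms)
  also have "\<dots> = (a - 2 * c) * (b / c)\<^sup>2"
    using \<open>c > 0\<close> by (simp add: field_simps power2_eq_square)
  also have "\<dots> < 0"
    using \<open>b \<noteq> 0\<close> \<open>c > 0\<close> \<open>a < c\<close> by (intro mult_neg_pos) auto
  finally show False by simp
qed

text \<open>The representing vector minimizes \<open>\<lambda>x. \<parallel>x\<parallel>\<^sup>2 - 2 f x\<close>.\<close>

lemma riesz_representation:
  fixes f :: "'a::{real_inner,complete_space} \<Rightarrow> real"
  assumes "bounded_linear f"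
  obtains z where "\<And>x. f x = inner x z"
proof -
  interpret f: bounded_linear f by fact
  obtain B where B: "\<And>x. norm (f x) \<le> norm x * B" using f.bounded by blast
  define \<phi> where "\<phi> x = (norm x)\<^sup>2 - 2 * f x" for x
  have "- B\<^sup>2 \<le> \<phi> x" for x
    using B[of x] zero_le_power2[of "norm x - B"] unfolding \<phi>_def
    by (simp add: power2_eq_square algebra_simps)
  then have bdd: "bdd_below (range \<phi>)" by (intro bdd_belowI[of _ "- B\<^sup>2"]) auto
  define m where "m = Inf (range \<phi>)"
  have m: "m \<le> \<phi> x" for x unfolding m_def using bdd by (auto intro: cInf_lower)
  have "\<exists>x. \<phi> x < m + 1 / Suc n" for n
    using cInf_lessD[of "range \<phi>" "m + 1 / Suc n"] by (auto simp: m_def)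
  then obtain x where x: "\<And>n. \<phi> (x n) < m + 1 / Suc n" by metis
  \<comment> \<open>Parallelogram identity: the midpoint \<open>w\<close> has value at least
    \<open>m\<close>, so two near-minimizers are close to each other and a minimizing sequence is
    Cauchy.\<close>
  have par: "(norm (u - v))\<^sup>2 \<le> 2 * \<phi> u + 2 * \<phi> v - 4 * m" for u v
  proof -
    define w where "w = (1/2) *\<^sub>R (u + v)"
    have "(norm (u - v))\<^sup>2 = 2 * \<phi> u + 2 * \<phi> v - 4 * \<phi> w"
      unfolding \<phi>_def w_def power2_norm_eq_inner
      by (simp add: inner_add_left inner_add_right inner_diff_left inner_diff_right f.scaleR f.add inner_commute field_simps)
    with m[of w] show ?thesis by simp
  qed
  have "Cauchy x"
  proof (rule metric_CauchyI)
    fix e :: real assume "e > 0"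
    then obtain M where M: "1 / Suc M < e\<^sup>2 / 4"
      using nat_approx_posE[of "e\<^sup>2 / 4"] by (auto simp: inverse_eq_divide)
    have "dist (x n) (x k) < e" if "n \<ge> M" "k \<ge> M" for n k
    proof -
      have "1 / real (Suc n) \<le> 1 / Suc M" "1 / real (Suc k) \<le> 1 / Suc M"
        using that by (simp_all add: frac_le)
      then have "(norm (x n - x k))\<^sup>2 < e\<^sup>2"
        using par[of "x n" "x k"] x[of n] x[of k] M by argo
      then show ?thesis
        using \<open>e > 0\<close> by (simp add: dist_norm power_less_imp_less_base)
    qed
    then show "\<exists>M. \<forall>m\<ge>M. \<forall>n\<ge>M. dist (x m) (x n) < e" by blast
  qed
  then obtain z where z: "x \<longlonglongrightarrow> z" using Cauchy_convergent convergent_def by blast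
  have "(\<lambda>n. \<phi> (x n)) \<longlonglongrightarrow> \<phi> z"
    unfolding \<phi>_def by (intro tendsto_intros z f.tendsto)
  moreover have "(\<lambda>n. m + 1 / Suc n) \<longlonglongrightarrow> m + 0"
    by (intro tendsto_intros LIMSEQ_Suc[OF lim_1_over_n])
  ultimately have "\<phi> z \<le> m"
    using LIMSEQ_le[of "\<lambda>n. \<phi> (x n)" "\<phi> z" "\<lambda>n. m + 1 / Suc n" m] x less_imp_le by auto
  have "f y = inner y z" for y
  proof -
    \<comment> \<open>This is \<open>\<phi> (z + t *\<^sub>R y) - \<phi> z\<close>, nonnegative
      because \<open>z\<close> is a minimizer.\<close>
    have "0 \<le> (norm y)\<^sup>2 * t\<^sup>2 + 2 * t * (inner y z - f y)" for t
    proof -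
      have "\<phi> z \<le> \<phi> (z + t *\<^sub>R y)" using \<open>\<phi> z \<le> m\<close> m order.trans by blast
      then show ?thesis
        unfolding \<phi>_def power2_norm_eq_inner
        by (simp add: inner_simps f.scaleR f.add inner_commute power2_eq_square algebra_simps)
    qed
    then show ?thesis using linear_coefficient_zero by fastforce
  qed
  then show thesis using that by blast
qed

text \<open>Justifies the definite description in \<open>cadjoint\<close>. Riesz representation for
  the real functional \<open>\<lambda>x. inner (T x) y\<close> gives the real part; the imaginary
  part follows by evaluating at \<open>scaleC (- \<i>) x\<close>.\<close>

lemma cadjoint_right:
  fixes T :: "'a::chilbert_space \<Rightarrow> 'b::chilbert_space"
  assumes T: "bounded_clinear T"
  shows "cinner (T x) y = cinner x (cadjoint T y)"
proof -
  have "\<exists>z. \<forall>x. cinner (T x) y = cinner x z" for y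
  proof -
    have "bounded_linear (\<lambda>x. inner (T x) y)"
      using bounded_linear_compose[OF bounded_linear_inner_left bounded_clinearD(1)[OF T]] .
    then obtain z where z: "\<And>x. inner (T x) y = inner x z"
      using riesz_representation by blast
    have "cinner (T x) y = cinner x z" for x
      using z[of x] z[of "scaleC (- \<i>) x"] bounded_clinearD(4)[OF T, of "- \<i>" x]
      by (simp add: complex_eq_iff Re_cinner Im_cinner)
    then show ?thesis by blast
  qed
  then obtain T' where T': "\<And>x y. cinner (T x) y = cinner x (T' y)" by metis
  have "cadjoint T = T'"
    unfolding cadjoint_def
  proof (rule the_equality)
    fix T'' assume "\<forall>x y. cinner (T x) y = cinner x (T'' y)"
    with T' show "T'' = T'" by (metis cinner_eqI ext)
  qed (use T' in blast)
  with T' show ?thesis by simp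
qed

lemma cadjoint_left:
  assumes "bounded_clinear T"
  shows "cinner (cadjoint T y) x = cinner y (T x)"
  using cadjoint_right[OF assms, of x y] by (metis cinner_commute)

lemma cadjoint_eqI:
  assumes "bounded_clinear T" "\<And>x y. cinner (T x) y = cinner x (T' y)"
  shows "cadjoint T = T'"
  by (rule ext, rule cinner_eqI) (metis assms cadjoint_right)

lemma norm_cadjoint_le:
  fixes T :: "'a::chilbert_space \<Rightarrow> 'b::chilbert_space"
  assumes T: "bounded_clinear T" and B: "\<And>x. norm (T x) \<le> B * norm x" "0 \<le> B"
  shows "norm (cadjoint T y) \<le> B * norm y"
proof (cases "cadjoint T y = 0")
  case False
  let ?z = "cadjoint T y"
  have "norm ?z * norm ?z = inner (T ?z) y"
    using cadjoint_right[OF T, of ?z y]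
    by (metis Re_cinner power2_eq_square power2_norm_eq_inner)
  also have "\<dots> \<le> norm (T ?z) * norm y" by (rule norm_cauchy_schwarz)
  also have "\<dots> \<le> B * norm ?z * norm y" by (intro mult_right_mono B) simp
  finally show ?thesis using False by (simp add: mult.assoc mult.left_commute)
qed (use B in simp)

lemma bounded_clinear_cadjoint:
  assumes T: "bounded_clinear T"
  shows "bounded_clinear (cadjoint T)"
  unfolding bounded_clinear_iff
proof (intro conjI allI exI)
  show "cadjoint T (x + y) = cadjoint T x + cadjoint T y" for x y
    by (rule cinner_eqI) (simp add: cadjoint_right[OF T, symmetric] cinner_add_right)
  show "cadjoint T (scaleC c x) = scaleC c (cadjoint T x)" for c x
    by (rule cinner_eqI) (simp add: cadjoint_right[OF T, symmetric] cinner_scaleC_right)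
  show "norm (cadjoint T y) \<le> onorm T * norm y" for y
    by (intro norm_cadjoint_le T bounded_clinearD onorm_pos_le)
qed

lemma cadjoint_cadjoint:
  assumes "bounded_clinear T"
  shows "cadjoint (cadjoint T) = T"
  using assms by (intro cadjoint_eqI bounded_clinear_cadjoint) (simp_all add: cadjoint_left)

lemma cadjoint_commute:
  assumes "bounded_clinear S" "bounded_clinear T" "\<And>x. S (T x) = T (S x)"
  shows "cadjoint S (cadjoint T x) = cadjoint T (cadjoint S x)"
  by (rule cinner_eqI) (simp add: cadjoint_right[symmetric] assms)

lemma norm_cadjoint_normal:
  assumes T: "bounded_clinear T" and "normal_op T"
  shows "norm (cadjoint T x) = norm (T x)"
proof -
  have "T (cadjoint T x) = cadjoint T (T x)" for x
    using assms(2) by (simp add: normal_op_def fun_eq_iff)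
  then have "cinner (cadjoint T x) (cadjoint T x) = cinner (T x) (T x)"
    by (simp add: cadjoint_left[OF T] cadjoint_right[OF T])
  then have "(norm (cadjoint T x))\<^sup>2 = (norm (T x))\<^sup>2"
    by (simp only: cinner_self of_real_eq_iff)
  then show ?thesis by (simp add: power2_eq_iff_nonneg)
qed

lemma normal_op_cadjoint:
  assumes "bounded_clinear T" "normal_op T"
  shows "normal_op (cadjoint T)"
  using assms by (simp add: normal_op_def cadjoint_cadjoint)

text \<open>Equality case of Cauchy-Schwarz: with \<open>y = cadjoint T (T x)\<close>,
  \<open>inner y x\<close> is the square of \<open>norm x\<close> while
  \<open>norm y \<le> norm x\<close>, which leaves no room for \<open>y - x\<close>.\<close>

lemma contraction_isometric_at:
  assumes T: "bounded_clinear T" and le: "\<And>x. norm (T x) \<le> norm x"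
    and x: "norm x \<le> norm (T x)"
  shows "cadjoint T (T x) = x"
proof -
  let ?y = "cadjoint T (T x)"
  have eq: "norm (T x) = norm x" by (intro order_antisym le x)
  have "inner ?y x = (norm x)\<^sup>2"
    using arg_cong[OF cadjoint_left[OF T, of "T x" x], of Re]
    by (simp add: Re_cinner eq flip: power2_norm_eq_inner)
  moreover have "norm ?y \<le> norm x"
    using norm_cadjoint_le[OF T, of 1 "T x"] le eq by simp
  then have "(norm ?y)\<^sup>2 \<le> (norm x)\<^sup>2" by (simp add: power_mono)
  ultimately have "(norm (?y - x))\<^sup>2 \<le> 0"
    unfolding power2_norm_eq_inner by (simp add: inner_diff inner_commute)
  then show ?thesis by simp
qed

section \<open>Unitary parts of normal contractions\<close>

text \<open>Cauchy-Schwarz for \<open>y\<close> and \<open>cadjoint V (V y)\<close>; normality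
  replaces the outer adjoint by \<open>V\<close> inside the norm. The sequence of norms of
  \<open>(V ^^ n) y\<close> is thus log-convex.\<close>

lemma normal_op_log_convex:
  assumes V: "bounded_clinear V" "normal_op V"
  shows "(norm (V y))\<^sup>2 \<le> norm y * norm (V (V y))"
proof -
  have "(norm (V y))\<^sup>2 = inner y (cadjoint V (V y))"
    using cadjoint_right[OF V(1), of y "V y"] by (metis Re_cinner power2_norm_eq_inner)
  also have "\<dots> \<le> norm y * norm (cadjoint V (V y))" by (rule norm_cauchy_schwarz)
  finally show ?thesis by (simp add: norm_cadjoint_normal[OF V])
qed

text \<open>Going backwards from \<open>x = V\<^sup>n (y n)\<close>, each step would grow by at least the factor
  \<open>\<parallel>x\<parallel> / \<parallel>V x\<parallel> > 1\<close>.\<close>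

lemma normal_op_bounded_preimages:
  assumes V: "bounded_clinear V" "normal_op V"
    and y: "\<And>n. (V ^^ n) (y n) = x" "\<And>n. norm (y n) \<le> C"
  shows "norm x \<le> norm (V x)"
proof (rule ccontr)
  assume "\<not> ?thesis"
  then have less: "norm (V x) < norm x" by simp
  define r where "r = norm (V x) / norm x"
  have "norm x > 0" using less by (metis norm_ge_zero order_le_less_trans)
  then have r: "0 \<le> r" "r < 1" and rx: "norm (V x) = r * norm x"
    using less by (simp_all add: r_def)
  \<comment> \<open>Log-convexity carries the ratio bound one step backwards, from
    \<open>V z\<close> to \<open>z\<close>.\<close>
  have step: "norm (V z) \<le> r * norm z" if "norm (V (V z)) \<le> r * norm (V z)" for z
  proof (cases "V z = 0")
    case False
    have "norm (V z) * norm (V z) \<le> norm z * norm (V (V z))"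
      using normal_op_log_convex[OF V, of z] by (simp add: power2_eq_square)
    also have "\<dots> \<le> norm z * (r * norm (V z))"
      using that by (intro mult_left_mono) auto
    finally show ?thesis using False by (simp add: mult.commute)
  qed (use r in simp)
  \<comment> \<open>The second conjunct is what the induction needs: the ratio bound reaches the
    start of the orbit, and its factors multiply up to \<open>r ^ n\<close>.\<close>
  have pow: "norm ((V ^^ n) z) \<le> r ^ n * norm z \<and> norm (V z) \<le> r * norm z"
    if "norm (V ((V ^^ n) z)) \<le> r * norm ((V ^^ n) z)" for n z
    using that
  proof (induction n arbitrary: z)
    case (Suc n)
    have "(V ^^ Suc n) z = (V ^^ n) (V z)" by (simp add: funpow_swap1)
    then have IH: "norm ((V ^^ n) (V z)) \<le> r ^ n * norm (V z)" "norm (V (V z)) \<le> r * norm (V z)"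
      using Suc by auto
    then have le: "norm (V z) \<le> r * norm z" using step by blast
    have "r ^ n * norm (V z) \<le> r ^ n * (r * norm z)"
      using le r by (intro mult_left_mono) auto
    with IH le show ?case by (simp add: funpow_swap1 mult.assoc mult.left_commute)
  qed simp
  have "norm x \<le> r ^ n * C" for n
  proof -
    have "norm x \<le> r ^ n * norm (y n)" using pow[of n "y n"] y(1)[of n] rx by simp
    also have "\<dots> \<le> r ^ n * C" using y(2) r by (intro mult_left_mono) auto
    finally show ?thesis .
  qed
  moreover have "(\<lambda>n. r ^ n * C) \<longlonglongrightarrow> 0 * C"
    using r by (intro tendsto_intros LIMSEQ_power_zero) auto
  ultimately have "norm x \<le> 0 * C" by (intro LIMSEQ_le_const) auto
  with \<open>norm x > 0\<close> show False by simp
qed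

text \<open>The powers of \<open>cadjoint V\<close> give \<open>k\<close> a bounded backward orbit
  under \<open>V\<close>. As \<open>A\<close> commutes with \<open>V\<close>, it maps this to a
  bounded backward orbit of \<open>A k\<close>, so \<open>V\<close> does not shrink
  \<open>A k\<close>; the equality case for contractions finishes.\<close>

lemma commuting_preserves_unitary_part:
  assumes V: "bounded_clinear V" "normal_op V" "\<And>x. norm (V x) \<le> norm x"
    and A: "bounded_clinear A" "\<And>x. A (V x) = V (A x)"
    and k: "cadjoint V (V k) = k"
  shows "cadjoint V (V (A k)) = A k"
proof -
  let ?W = "cadjoint V"
  have VW: "V (?W x) = ?W (V x)" for x
    using V(2) by (simp add: normal_op_def fun_eq_iff)
  have AV: "(V ^^ n) (A x) = A ((V ^^ n) x)" for n x
    by (induction n) (simp_all add: A)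
  have VV: "(V ^^ n) (V x) = V ((V ^^ n) x)" for n x by (simp add: funpow_swap1)
  have WV: "(V ^^ n) (?W x) = ?W ((V ^^ n) x)" for n x
    by (induction n) (simp_all add: VW)
  have inv: "(V ^^ n) ((?W ^^ n) k) = k" for n
  proof (induction n)
    case (Suc n)
    have "(V ^^ Suc n) ((?W ^^ Suc n) k) = V (?W ((V ^^ n) ((?W ^^ n) k)))"
      by (simp add: WV)
    with Suc k VW show ?case by simp
  qed simp
  have le: "norm (?W x) \<le> norm x" for x
    using norm_cadjoint_le[OF V(1), of 1 x] V(3) by simp
  have lek: "norm ((?W ^^ n) k) \<le> norm k" for n
    by (induction n) (auto intro: order_trans[OF le])
  have "norm (A ((?W ^^ n) k)) \<le> onorm A * norm k" for n
    by (rule order_trans[OF bounded_clinearD(7)[OF A(1)]])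
       (intro mult_left_mono lek onorm_pos_le bounded_clinearD A)
  then have "norm (A k) \<le> norm (V (A k))"
    by (intro normal_op_bounded_preimages[OF V(1,2), where y = "\<lambda>n. A ((?W ^^ n) k)"])
       (simp_all add: AV inv)
  then show ?thesis by (intro contraction_isometric_at V)
qed

section \<open>Extension from a dense subspace\<close>

lemma closure_add_closed:
  fixes S :: "'a::real_normed_vector set"
  assumes S: "\<And>x y. x \<in> S \<Longrightarrow> y \<in> S \<Longrightarrow> x + y \<in> S" and "x \<in> closure S" "y \<in> closure S"
  shows "x + y \<in> closure S"
proof -
  obtain f g where "\<forall>n. f n \<in> S" "f \<longlonglongrightarrow> x" "\<forall>n. g n \<in> S" "g \<longlonglongrightarrow> y"
    using assms(2,3) unfolding closure_sequential by blast
  then show ?thesis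
    unfolding closure_sequential using S
    by (intro exI[of _ "\<lambda>n. f n + g n"]) (auto intro: tendsto_add)
qed

text \<open>A relation spares the choice of a representation for each vector of the domain. The
  bound makes the closure of \<open>G\<close> single-valued, and with completeness and density it
  makes the closure defined everywhere.\<close>

lemma bounded_extension_of_dense_graph:
  fixes G :: "('a::chilbert_space \<times> 'b::chilbert_space) set"
  assumes ne: "(0, 0) \<in> G"
    and add: "\<And>u v u' v'. (u, v) \<in> G \<Longrightarrow> (u', v') \<in> G \<Longrightarrow> (u + u', v + v') \<in> G"
    and sc: "\<And>c u v. (u, v) \<in> G \<Longrightarrow> (scaleC c u, scaleC c v) \<in> G"
    and bound: "\<And>u v. (u, v) \<in> G \<Longrightarrow> norm v \<le> B * norm u"
    and dense: "closure (fst ` G) = UNIV"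
  obtains Y where "bounded_clinear Y" "\<And>u. norm (Y u) \<le> B * norm u"
    "\<And>u v. (u, v) \<in> G \<Longrightarrow> Y u = v"
proof -
  let ?C = "closure G"
  have minus: "(u - u', v - v') \<in> G" if "(u, v) \<in> G" "(u', v') \<in> G" for u v u' v'
    using add[OF that(1) sc[OF that(2), of "-1"]] by (simp add: scaleC_minus_left)
  have Cadd: "(u + u', v + v') \<in> ?C" if uv: "(u, v) \<in> ?C" "(u', v') \<in> ?C" for u v u' v'
  proof -
    have "p + q \<in> G" if "p \<in> G" "q \<in> G" for p q
      using add[of "fst p" "snd p" "fst q" "snd q"] that by (simp add: plus_prod_def)
    then show ?thesis using closure_add_closed[OF _ uv] by simp
  qed
  have Csc: "(scaleC c u, scaleC c v) \<in> ?C" if "(u, v) \<in> ?C" for c u v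
  proof -
    obtain f where f: "\<forall>n. f n \<in> G" "f \<longlonglongrightarrow> (u, v)"
      using \<open>(u, v) \<in> ?C\<close> unfolding closure_sequential by blast
    have "(scaleC c (fst (f n)), scaleC c (snd (f n))) \<in> G" for n
      using f(1) sc by simp
    moreover have "(\<lambda>n. (scaleC c (fst (f n)), scaleC c (snd (f n)))) \<longlonglongrightarrow> (scaleC c u, scaleC c v)"
      using tendsto_fst[OF f(2)] tendsto_snd[OF f(2)]
      by (intro tendsto_Pair bounded_linear.tendsto[OF bounded_linear_scaleC]) simp_all
    ultimately show ?thesis
      unfolding closure_sequential
      by (intro exI[of _ "\<lambda>n. (scaleC c (fst (f n)), scaleC c (snd (f n)))"]) blast
  qed
  have Cbound: "norm v \<le> B * norm u" if "(u, v) \<in> ?C" for u v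
  proof -
    obtain f where f: "\<forall>n. f n \<in> G" "f \<longlonglongrightarrow> (u, v)"
      using \<open>(u, v) \<in> ?C\<close> unfolding closure_sequential by blast
    have "norm (snd (f n)) \<le> B * norm (fst (f n))" for n
      using f(1) bound by simp
    moreover have "(\<lambda>n. norm (snd (f n))) \<longlonglongrightarrow> norm v" "(\<lambda>n. B * norm (fst (f n))) \<longlonglongrightarrow> B * norm u"
      using tendsto_fst[OF f(2)] tendsto_snd[OF f(2)] by (auto intro!: tendsto_intros)
    ultimately show ?thesis by (meson LIMSEQ_le)
  qed
  have Cuniq: "v = v'" if "(u, v) \<in> ?C" "(u, v') \<in> ?C" for u v v'
    using Cbound[OF Cadd[OF that(1) Csc[OF that(2), of "-1"]]]
    by (simp add: scaleC_minus_left)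
  have Cex: "\<exists>v. (u, v) \<in> ?C" for u
  proof -
    have "u \<in> closure (fst ` G)" using dense by simp
    then obtain f where f: "\<forall>n. f n \<in> fst ` G" "f \<longlonglongrightarrow> u"
      unfolding closure_sequential by blast
    then have "\<forall>n. \<exists>v. (f n, v) \<in> G" by force
    then obtain g where g: "\<And>n. (f n, g n) \<in> G" by metis
    have "Cauchy g"
    proof (rule metric_CauchyI)
      fix e :: real assume "e > 0"
      have "Cauchy f" using f(2) by (rule LIMSEQ_imp_Cauchy)
      \<comment> \<open>The sign of \<open>B\<close> is unknown, hence the positive denominator
        \<open>\<bar>B\<bar> + 1\<close>.\<close>
      then obtain M where M: "\<And>m n. m \<ge> M \<Longrightarrow> n \<ge> M \<Longrightarrow> dist (f m) (f n) < e / (\<bar>B\<bar> + 1)"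
        using metric_CauchyD[of f "e / (\<bar>B\<bar> + 1)"] \<open>e > 0\<close>
        by (metis abs_ge_zero add_nonneg_pos divide_pos_pos zero_less_one)
      have "dist (g m) (g n) < e" if "m \<ge> M" "n \<ge> M" for m n
      proof -
        have "dist (g m) (g n) \<le> B * dist (f m) (f n)"
          using bound[OF minus[OF g[of m] g[of n]]] by (simp add: dist_norm)
        also have "\<dots> \<le> (\<bar>B\<bar> + 1) * dist (f m) (f n)" by (intro mult_right_mono) auto
        also have "\<dots> < e" using M[OF that] by (simp add: field_simps)
        finally show ?thesis .
      qed
      then show "\<exists>M. \<forall>m\<ge>M. \<forall>n\<ge>M. dist (g m) (g n) < e" by blast
    qed
    then obtain v where "g \<longlonglongrightarrow> v" using Cauchy_convergent convergent_def by blast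
    with f(2) have "(\<lambda>n. (f n, g n)) \<longlonglongrightarrow> (u, v)" by (rule tendsto_Pair)
    with g show ?thesis
      unfolding closure_sequential by (intro exI[of _ v] exI[of _ "\<lambda>n. (f n, g n)"]) blast
  qed
  obtain Y where Y: "\<And>u. (u, Y u) \<in> ?C" using Cex by metis
  have Yeq: "Y u = v" if "(u, v) \<in> ?C" for u v using Cuniq[OF Y that] .
  show thesis
  proof
    show "norm (Y u) \<le> B * norm u" for u by (rule Cbound[OF Y])
    then show "bounded_clinear Y"
      unfolding bounded_clinear_iff using Yeq[OF Cadd[OF Y Y]] Yeq[OF Csc[OF Y]] by blast
    show "Y u = v" if "(u, v) \<in> G" for u v using that closure_subset Yeq by blast
  qed
qed

section \<open>The symmetrized polydisc\<close>

lemma poly_op_add: "poly_op d (f + g) T h = poly_op d f T h + poly_op d g T h"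
  unfolding poly_op_def
  by (rule setsum_keys_plus_distrib) (simp_all add: scaleC_add_left)

lemma poly_op_single: "poly_op d (Poly_Mapping.single m c) T h = scaleC c (monom_op d m T h)"
  by (simp add: poly_op_def)

lemma poly_eval_add: "poly_eval d (f + g) z = poly_eval d f z + poly_eval d g z"
  unfolding poly_eval_def
  by (rule setsum_keys_plus_distrib) (simp_all add: algebra_simps)

lemma poly_eval_single:
  "poly_eval d (Poly_Mapping.single m c) z = c * (\<Prod>i\<in>{1..d}. z i ^ Poly_Mapping.lookup m i)"
  by (simp add: poly_eval_def)

lemma poly_ring_add: "f \<in> poly_ring d \<Longrightarrow> g \<in> poly_ring d \<Longrightarrow> f + g \<in> poly_ring d"
  unfolding poly_ring_def using keys_add[of f g] by blast

lemma poly_ring_single: "Poly_Mapping.keys m \<subseteq> {1..d} \<Longrightarrow> Poly_Mapping.single m c \<in> poly_ring d"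
  by (simp add: poly_ring_def)

text \<open>An exponent rather than a polynomial: the coordinate polynomial is
  \<open>Poly_Mapping.single (var i) 1\<close>.\<close>

abbreviation var :: "nat \<Rightarrow> nat \<Rightarrow>\<^sub>0 nat" where
  "var i \<equiv> Poly_Mapping.single i (Suc 0)"

lemma prod_var:
  fixes z :: "nat \<Rightarrow> complex"
  assumes "i \<in> {1..d}"
  shows "(\<Prod>k\<in>{1..d}. z k ^ Poly_Mapping.lookup (var i) k) = z i"
proof -
  have "(\<Prod>k\<in>{1..d}. z k ^ Poly_Mapping.lookup (var i) k) = (\<Prod>k\<in>{1..d}. if i = k then z k else 1)"
    by (intro prod.cong) (auto simp: lookup_single when_def)
  also have "\<dots> = z i" using assms by simp
  finally show ?thesis .
qed

lemma foldr_funpow_id: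
  "(\<And>i. i \<in> set xs \<Longrightarrow> p i = 0) \<Longrightarrow> foldr (\<lambda>i A. (T i ^^ p i) \<circ> A) xs A = A"
  by (induction xs) simp_all

lemma upt_split_at: "1 \<le> i \<Longrightarrow> i \<le> d \<Longrightarrow> [1..<Suc d] = [1..<i] @ i # [Suc i..<Suc d]"
  using upt_add_eq_append[of 1 i "Suc d - i"] upt_conv_Cons[of i "Suc d"] by simp

lemma monom_op_var:
  fixes T :: "nat \<Rightarrow> 'a \<Rightarrow> 'a"
  assumes "i \<in> {1..d}"
  shows "monom_op d (var i) T = T i"
proof -
  have "foldr (\<lambda>k A. (T k ^^ Poly_Mapping.lookup (var i) k) \<circ> A) xs A = A" if "i \<notin> set xs" for xs and A :: "'a \<Rightarrow> 'a"
    using that by (intro foldr_funpow_id) (auto simp: lookup_single when_def)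
  then show ?thesis
    using assms unfolding monom_op_def
    by (subst upt_split_at[of i d]) (simp_all del: upt_Suc)
qed

text \<open>The quadratic monomial of the test polynomial in
  \<open>contractive_module_reflection\<close>. As \<open>i < d\<close>, the factor
  \<open>T i\<close> stands outside \<open>T d\<close> in the ordered composition.\<close>

lemma monom_op_var_var:
  fixes T :: "nat \<Rightarrow> 'a \<Rightarrow> 'a"
  assumes "1 \<le> i" "i < d"
  shows "monom_op d (var i + var d) T h = T i (T d h)"
proof -
  let ?p = "Poly_Mapping.lookup (var i + var d)"
  have split: "[1..<Suc d] = ([1..<i] @ i # [Suc i..<d]) @ [d]"
    using assms upt_split_at[of i d] by simp
  have "foldr (\<lambda>k A. (T k ^^ ?p k) \<circ> A) xs A = A" if "i \<notin> set xs" "d \<notin> set xs" for xs and A :: "'a \<Rightarrow> 'a"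
    using that by (intro foldr_funpow_id) (auto simp: lookup_add lookup_single when_def)
  moreover have "?p i = 1" "?p d = 1"
    using assms by (simp_all add: lookup_add lookup_single)
  ultimately show ?thesis
    using assms unfolding monom_op_def split by simp
qed

section \<open>Reducing suprema over the symmetrized polydisc to the torus\<close>

lemma elem_sym_holomorphic: "(\<lambda>w. elem_sym d k (z(j := w))) holomorphic_on A"
proof -
  have "(\<lambda>w. (z(j := w)) i) holomorphic_on A" for i
    by (cases "i = j") (auto intro: holomorphic_intros)
  then show ?thesis
    unfolding elem_sym_def by (intro holomorphic_intros)
qed

text \<open>The maximum principle is applied to one coordinate of the polydisc at a time.\<close>

lemma poly_bound_torus_imp_polydisc:
  assumes torus: "\<And>z. (\<And>j. j \<in> {1..d} \<Longrightarrow> cmod (z j) = 1) \<Longrightarrow>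
      cmod (poly_eval d f (\<lambda>k. elem_sym d k z)) \<le> B"
    and z: "\<And>j. j \<in> {1..d} \<Longrightarrow> cmod (z j) \<le> 1"
  shows "cmod (poly_eval d f (\<lambda>k. elem_sym d k z)) \<le> B"
proof -
  \<comment> \<open>Induction on a set \<open>A\<close> outside which all coordinates are already
    unimodular; \<open>A = {1..d}\<close> is the claim.\<close>
  have "cmod (poly_eval d f (\<lambda>k. elem_sym d k z)) \<le> B"
    if "finite A" "\<And>j. j \<in> {1..d} - A \<Longrightarrow> cmod (z j) = 1" "\<And>j. j \<in> {1..d} \<Longrightarrow> cmod (z j) \<le> 1"
    for A z
    using that
  proof (induction A arbitrary: z)
    case empty
    then show ?case by (intro torus) auto
  next
    case (insert a A)
    show ?case
    proof (cases "a \<in> {1..d}")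
      case False
      then show ?thesis using insert by (intro insert.IH) auto
    next
      case True
      let ?g = "\<lambda>w. poly_eval d f (\<lambda>k. elem_sym d k (z(a := w)))"
      have hol: "?g holomorphic_on X" for X
        unfolding poly_eval_def by (intro holomorphic_intros elem_sym_holomorphic)
      have "cmod (?g (z a)) \<le> B"
      proof (rule maximum_modulus_frontier[where f = ?g and S = "cball 0 1"])
        show "cmod (?g w) \<le> B" if "w \<in> frontier (cball 0 1)" for w
        proof (rule insert.IH)
          show "cmod ((z(a := w)) j) = 1" if "j \<in> {1..d} - A" for j
            using that \<open>w \<in> _\<close> insert.prems(1)[of j] by (auto simp: frontier_cball)
          show "cmod ((z(a := w)) j) \<le> 1" if "j \<in> {1..d}" for j
            using that \<open>w \<in> _\<close> insert.prems(2)[of j] by (auto simp: frontier_cball)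
        qed
        show "z a \<in> cball 0 1" using insert.prems(2)[OF True] by simp
      qed (use hol holomorphic_on_imp_continuous_on in auto)
      then show ?thesis by simp
    qed
  qed
  from this[of "{1..d}" z] z show ?thesis by simp
qed

lemma Sup_sym_polydisc_le:
  assumes "\<And>z. (\<And>j. j \<in> {1..d} \<Longrightarrow> cmod (z j) = 1) \<Longrightarrow>
      cmod (poly_eval d f (\<lambda>k. elem_sym d k z)) \<le> B"
  shows "(SUP s\<in>sym_polydisc d. cmod (poly_eval d f s)) \<le> B"
proof (rule cSUP_least)
  \<comment> \<open>The image of the origin shows that the supremum is over a nonempty set.\<close>
  have "restrict (\<lambda>k. elem_sym d k (\<lambda>_. 0)) {1..d} \<in> sym_polydisc d"
    unfolding sym_polydisc_def by (intro CollectI exI[of _ "\<lambda>_. 0"]) simp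
  then show "sym_polydisc d \<noteq> {}" by blast
next
  fix s assume "s \<in> sym_polydisc d"
  then obtain z where z: "\<forall>j\<in>{1..d}. cmod (z j) \<le> 1"
    and s: "s = restrict (\<lambda>k. elem_sym d k z) {1..d}"
    unfolding sym_polydisc_def by blast
  have "poly_eval d f s = poly_eval d f (\<lambda>k. elem_sym d k z)"
    unfolding poly_eval_def s by (intro sum.cong prod.cong arg_cong2[where f = "(*)"]) auto
  then show "cmod (poly_eval d f s) \<le> B"
    using poly_bound_torus_imp_polydisc[OF assms] z by simp
qed

section \<open>Elementary symmetric polynomials on the torus\<close>

lemma elem_sym_top: "elem_sym d d z = (\<Prod>j\<in>{1..d}. z j)"
proof -
  have "{I. I \<subseteq> {1..d} \<and> card I = d} = {{1..d}}"
    using card_subset_eq[of "{1..d}"] by auto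
  then show ?thesis by (simp add: elem_sym_def)
qed

text \<open>On the torus conjugation inverts each coordinate, so the product over \<open>I\<close>
  is the full product times the conjugate of the product over the complement. Complementation
  matches the subsets of size \<open>k\<close> with those of size \<open>d - k\<close>.\<close>

lemma elem_sym_torus_reflection:
  assumes torus: "\<And>j. j \<in> {1..d} \<Longrightarrow> cmod (z j) = 1" and "k \<le> d"
  shows "elem_sym d k z = elem_sym d d z * cnj (elem_sym d (d - k) z)"
proof -
  have compl: "(\<Prod>j\<in>{1..d}. z j) * cnj (\<Prod>j\<in>{1..d} - I. z j) = (\<Prod>j\<in>I. z j)" if "I \<subseteq> {1..d}" for I
  proof -
    have "(\<Prod>j\<in>{1..d}. z j) = (\<Prod>j\<in>{1..d} - I. z j) * (\<Prod>j\<in>I. z j)"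
      using that by (intro prod.subset_diff) auto
    moreover have "(\<Prod>j\<in>{1..d} - I. z j) * cnj (\<Prod>j\<in>{1..d} - I. z j) = 1"
      using torus
      by (simp add: prod.distrib[symmetric], intro prod.neutral)
         (simp flip: complex_norm_square)
    ultimately show ?thesis by (simp add: mult_ac)
  qed
  have "elem_sym d k z = (\<Sum>I | I \<subseteq> {1..d} \<and> card I = d - k. \<Prod>j\<in>{1..d} - I. z j)"
    unfolding elem_sym_def using \<open>k \<le> d\<close>
    by (intro sum.reindex_bij_witness[where i = "\<lambda>I. {1..d} - I" and j = "\<lambda>I. {1..d} - I"])
       (auto simp: double_diff card_Diff_subset finite_subset[of _ "{1..d}"])
  also have "\<dots> = (\<Sum>I | I \<subseteq> {1..d} \<and> card I = d - k. (\<Prod>j\<in>{1..d}. z j) * cnj (\<Prod>j\<in>I. z j))"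
  proof (intro sum.cong refl)
    fix I assume "I \<in> {I. I \<subseteq> {1..d} \<and> card I = d - k}"
    then show "(\<Prod>j\<in>{1..d} - I. z j) = (\<Prod>j\<in>{1..d}. z j) * cnj (\<Prod>j\<in>I. z j)"
      using compl[of "{1..d} - I"] by (simp add: double_diff)
  qed
  also have "\<dots> = elem_sym d d z * cnj (elem_sym d (d - k) z)"
    by (simp only: elem_sym_top) (simp add: elem_sym_def sum_distrib_left)
  finally show ?thesis .
qed

text \<open>A crude count of subsets; only a bound uniform over the torus matters.\<close>

lemma norm_elem_sym_torus_le:
  assumes "\<And>j. j \<in> {1..d} \<Longrightarrow> cmod (z j) = 1"
  shows "cmod (elem_sym d k z) \<le> 2 ^ d"
proof -
  have "cmod (elem_sym d k z) \<le> (\<Sum>I | I \<subseteq> {1..d} \<and> card I = k. 1)"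
    unfolding elem_sym_def
    by (rule sum_norm_le) (auto simp: prod_norm[symmetric] assms intro!: prod_le_1)
  also have "\<dots> \<le> real (card (Pow {1..d}))"
    by (simp del: card_Pow) (intro card_mono, auto)
  finally show ?thesis by (simp add: card_Pow)
qed

section \<open>Contractive modules whose last operator is unitary\<close>

text \<open>The last coordinate is the product of all \<open>z j\<close>, of modulus 1 on the torus,
  so the polynomial \<open>z d\<close> has supremum at most 1.\<close>

lemma norm_last_le:
  assumes "contractive_hilbert_module d R" "1 \<le> d"
  shows "norm (R d h) \<le> norm h"
proof -
  let ?f = "Poly_Mapping.single (var d) 1 :: (nat \<Rightarrow>\<^sub>0 nat) \<Rightarrow>\<^sub>0 complex"
  have op: "poly_op d ?f R h = R d h"
    using assms(2) by (simp add: poly_op_single monom_op_var)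
  have ev: "poly_eval d ?f z = z d" for z
    using assms(2) by (simp add: poly_eval_single prod_var del: One_nat_def)
  have "?f \<in> poly_ring d"
    using assms(2) by (intro poly_ring_single) simp
  then have "norm (R d h) \<le> (SUP s\<in>sym_polydisc d. cmod (poly_eval d ?f s)) * norm h"
    using assms(1) op unfolding contractive_hilbert_module_def by metis
  also have "\<dots> \<le> 1 * norm h"
    unfolding ev elem_sym_top
    by (intro mult_right_mono Sup_sym_polydisc_le[of d ?f 1, unfolded ev elem_sym_top])
       (auto simp: prod_norm[symmetric])
  finally show ?thesis by simp
qed

text \<open>On the torus \<open>s\<^sub>i = p * cnj s\<^bsub>d - i\<^esub>\<close>, so that
  \<open>p + \<epsilon> (\<alpha> s\<^sub>i - cnj \<alpha> s\<^bsub>d - i\<^esub> p) = p (1 + 2 \<i> \<epsilon> Im (\<alpha> cnj s\<^bsub>d - i\<^esub>))\<close> has modulus \<open>1 + O(\<epsilon>\<^sup>2)\<close>.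
  Contractivity then forces the term linear in \<open>\<epsilon>\<close> to vanish.\<close>

lemma contractive_module_reflection:
  assumes R: "contractive_hilbert_module d R" and i: "1 \<le> i" "i < d"
    and iso: "\<And>x. cadjoint (R d) (R d x) = x"
  shows "cadjoint (R (d - i)) h = cadjoint (R d) (R i h)"
proof -
  let ?e = "d - i"
  have e: "1 \<le> ?e" "?e < d" using i by auto
  have bcl: "bounded_clinear (R j)" if "j \<in> {1..d}" for j
    using R that by (auto simp: contractive_hilbert_module_def commuting_tuple_def)
  have comm: "R j (R k x) = R k (R j x)" if "j \<in> {1..d}" "k \<in> {1..d}" for j k x
    using R that by (auto simp: contractive_hilbert_module_def commuting_tuple_def fun_eq_iff)
  have bd: "bounded_clinear (R d)" and bi: "bounded_clinear (R i)" and be: "bounded_clinear (R ?e)"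
    using i e bcl by auto
  have isoc: "cinner (R d x) (R d y) = cinner x y" for x y
    by (simp add: cadjoint_right[OF bd] iso)
  have ison: "norm (R d x) = norm x" for x
    by (metis isoc Re_cinner norm_eq_sqrt_inner)
  have form: "Re (\<alpha> * (cinner (R i h) (R d h) - cinner h (R ?e h))) = 0" for \<alpha> h
  proof -
    \<comment> \<open>The coefficient of \<open>\<epsilon>\<close> in \<open>f\<close> applied to
      the tuple \<open>R\<close> and \<open>h\<close>, for the test polynomial \<open>f\<close>
      below.\<close>
    define W where "W = scaleC \<alpha> (R i h) - scaleC (cnj \<alpha>) (R ?e (R d h))"
    \<comment> \<open>An upper bound on the torus for the square of twice the imaginary part of
      \<open>\<alpha> * cnj (elem_sym d ?e z)\<close>.\<close>
    define C where "C = (2 * (cmod \<alpha> * 2 ^ d))\<^sup>2"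
    \<comment> \<open>The squared contractivity inequality for \<open>f\<close>: as
      \<open>R d\<close> is isometric, the terms of order zero in \<open>\<epsilon>\<close>
      cancel.\<close>
    have "0 \<le> (C * (norm h)\<^sup>2 - (norm W)\<^sup>2) * \<epsilon>\<^sup>2 + 2 * \<epsilon> * (- inner (R d h) W)" for \<epsilon> :: real
    proof -
      define f where "f = Poly_Mapping.single (var d) 1 +
        (Poly_Mapping.single (var i) (of_real \<epsilon> * \<alpha>) +
         Poly_Mapping.single (var ?e + var d) (- (of_real \<epsilon> * cnj \<alpha>)))"
      have f: "f \<in> poly_ring d"
        unfolding f_def using i e keys_add[of "var ?e" "var d"]
        by (intro poly_ring_add poly_ring_single) auto
      have op: "poly_op d f R h = R d h + \<epsilon> *\<^sub>R W"
        unfolding f_def W_def using i e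
        by (simp add: poly_op_add poly_op_single monom_op_var monom_op_var_var scaleC_minus_left
            scaleC_scaleC scaleC_diff_right flip: scaleC_of_real)
      have ev: "poly_eval d f s = s d + of_real \<epsilon> * (\<alpha> * s i - cnj \<alpha> * s ?e * s d)" for s
        unfolding f_def using i e
        by (simp add: poly_eval_add poly_eval_single prod_var lookup_add power_add prod.distrib
            algebra_simps del: One_nat_def)
      have "(SUP s\<in>sym_polydisc d. cmod (poly_eval d f s)) \<le> sqrt (1 + C * \<epsilon>\<^sup>2)"
      proof (rule Sup_sym_polydisc_le)
        fix z :: "nat \<Rightarrow> complex" assume z: "\<And>j. j \<in> {1..d} \<Longrightarrow> cmod (z j) = 1"
        let ?w = "\<alpha> * cnj (elem_sym d ?e z)"
        have one: "cmod (elem_sym d d z) = 1"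
          using z by (simp add: elem_sym_top prod_norm[symmetric])
        have "poly_eval d f (\<lambda>k. elem_sym d k z) =
            elem_sym d d z * (1 + of_real \<epsilon> * (?w - cnj ?w))"
          using elem_sym_torus_reflection[of d z i, OF z] i unfolding ev
          by (simp add: algebra_simps)
        also have "?w - cnj ?w = \<i> * of_real (2 * Im ?w)"
          by (simp add: complex_eq_iff)
        finally have "cmod (poly_eval d f (\<lambda>k. elem_sym d k z)) =
            cmod (Complex 1 (\<epsilon> * (2 * Im ?w)))"
          by (simp only: norm_mult one) (simp add: complex_eq_iff cmod_def)
        also have "\<dots> = sqrt (1 + (2 * Im ?w)\<^sup>2 * \<epsilon>\<^sup>2)"
          by (simp add: cmod_def power_mult_distrib mult_ac)
        also have "\<dots> \<le> sqrt (1 + C * \<epsilon>\<^sup>2)"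
        proof -
          have "\<bar>Im ?w\<bar> \<le> cmod ?w" by (rule abs_Im_le_cmod)
          also have "\<dots> \<le> cmod \<alpha> * 2 ^ d"
            using norm_elem_sym_torus_le[of d z ?e, OF z] by (simp add: norm_mult mult_left_mono)
          finally have "(2 * Im ?w)\<^sup>2 \<le> C"
            unfolding C_def by (intro abs_le_square_iff[THEN iffD1]) simp
          then show ?thesis by (simp add: mult_right_mono)
        qed
        finally show "cmod (poly_eval d f (\<lambda>k. elem_sym d k z)) \<le> sqrt (1 + C * \<epsilon>\<^sup>2)" .
      qed
      then have "norm (R d h + \<epsilon> *\<^sub>R W) \<le> sqrt (1 + C * \<epsilon>\<^sup>2) * norm h"
        using R f op unfolding contractive_hilbert_module_def
        by (metis mult_right_mono norm_ge_zero order_trans)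
      then have "(norm (R d h + \<epsilon> *\<^sub>R W))\<^sup>2 \<le> (sqrt (1 + C * \<epsilon>\<^sup>2) * norm h)\<^sup>2"
        by (intro power_mono) auto
      moreover have "(sqrt (1 + C * \<epsilon>\<^sup>2) * norm h)\<^sup>2 = (1 + C * \<epsilon>\<^sup>2) * (norm h)\<^sup>2"
        by (simp add: power_mult_distrib C_def)
      moreover have "(norm (R d h + \<epsilon> *\<^sub>R W))\<^sup>2
          = (norm h)\<^sup>2 + 2 * \<epsilon> * inner (R d h) W + \<epsilon>\<^sup>2 * (norm W)\<^sup>2"
        unfolding ison[of h, symmetric] power2_norm_eq_inner
        by (simp add: inner_add_left inner_add_right inner_commute power2_eq_square)
      ultimately show ?thesis by (simp add: algebra_simps)
    qed
    then have "inner (R d h) W = 0"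
      using linear_coefficient_zero by fastforce
    moreover have "inner (R d h) W = Re (cinner W (R d h))"
      by (simp add: Re_cinner inner_commute)
    moreover have "cinner (R ?e (R d h)) (R d h) = cinner (R ?e h) h"
      using i e by (simp add: comm[of ?e d] isoc)
    ultimately show ?thesis
      using arg_cong[OF cinner_commute[of h "R ?e h"], of Re]
        arg_cong[OF cinner_commute[of h "R ?e h"], of Im]
      by (simp add: W_def cinner_diff_left cinner_scaleC_left algebra_simps)
  qed
  \<comment> \<open>The values 1 and \<open>\<i>\<close> of \<open>\<alpha>\<close> isolate the real
    and the imaginary part.\<close>
  have eq: "cinner (R i h) (R d h) = cinner h (R ?e h)" for h
    using form[of 1 h] form[of \<i> h] by (simp add: complex_eq_iff)
  have "cadjoint (R d) (R i h) - cadjoint (R ?e) h = 0"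
    by (rule cinner_polarization_zero[where T = "\<lambda>h. cadjoint (R d) (R i h) - cadjoint (R ?e) h"])
       (simp_all add: bounded_clinear_diff bounded_clinear_cadjoint be cinner_diff_left
          bounded_clinear_compose[OF bounded_clinear_cadjoint[OF bd] bi]
          cadjoint_left[OF bd] cadjoint_left[OF be] eq)
  then show ?thesis by simp
qed

section \<open>Canonical embeddings\<close>

lemma module_map_intertwines:
  assumes "module_map d S R L" "i \<in> {1..d}"
  shows "L (S i h) = R i (L h)"
proof -
  let ?f = "Poly_Mapping.single (var i) 1 :: (nat \<Rightarrow>\<^sub>0 nat) \<Rightarrow>\<^sub>0 complex"
  have "?f \<in> poly_ring d" using assms(2) by (intro poly_ring_single) simp
  then have "L (poly_op d ?f S h) = poly_op d ?f R (L h)"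
    using assms(1) unfolding module_map_def by blast
  then show ?thesis using assms(2) by (simp add: poly_op_single monom_op_var)
qed

lemma single_operator_module_mapI:
  assumes L: "bounded_clinear L" and comm: "\<And>h. L (X h) = Y (L h)"
  shows "module_map 1 (\<lambda>_. X) (\<lambda>_. Y) L"
proof -
  have pow: "L ((X ^^ n) h) = (Y ^^ n) (L h)" for n h
    by (induction n) (simp_all add: comm)
  have "L (poly_op 1 f (\<lambda>_. X) h) = poly_op 1 f (\<lambda>_. Y) (L h)" for f h
    by (simp add: poly_op_def monom_op_def bounded_clinearD[OF L] pow)
  with L show ?thesis by (simp add: module_map_def)
qed

text \<open>Pairing the limit with \<open>h\<close> turns the operators into squared norms of
  \<open>(P ^^ n) h\<close>. In this form the limit condition on a canonical embedding enters every
  estimate.\<close>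

lemma canonical_norm_limit:
  fixes P :: "'a::chilbert_space \<Rightarrow> 'a"
  assumes P: "bounded_clinear P" and J: "bounded_clinear J"
    and lim: "(\<lambda>n. (cadjoint P ^^ n) ((P ^^ n) h)) \<longlonglongrightarrow> cadjoint J (J h)"
  shows "(\<lambda>n. norm ((P ^^ n) h)) \<longlonglongrightarrow> norm (J h)"
proof -
  have adj: "cinner ((cadjoint P ^^ n) x) y = cinner x ((P ^^ n) y)" for n x y
  proof (induction n arbitrary: y)
    case (Suc n)
    then show ?case by (simp add: cadjoint_left[OF P] funpow_swap1[of P])
  qed simp
  have "(\<lambda>n. inner ((cadjoint P ^^ n) ((P ^^ n) h)) h) \<longlonglongrightarrow> inner (cadjoint J (J h)) h"
    by (intro tendsto_intros lim)
  then have "(\<lambda>n. (norm ((P ^^ n) h))\<^sup>2) \<longlonglongrightarrow> (norm (J h))\<^sup>2"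
    by (simp add: Re_cinner[symmetric] adj cadjoint_left[OF J])
       (simp add: cinner_self)
  then have "(\<lambda>n. sqrt ((norm ((P ^^ n) h))\<^sup>2)) \<longlonglongrightarrow> sqrt ((norm (J h))\<^sup>2)"
    by (rule tendsto_real_sqrt)
  then show ?thesis by simp
qed

lemma canonical_embedding_last_unitary:
  assumes d: "1 \<le> d" and S: "contractive_hilbert_module d S"
    and R: "contractive_hilbert_module d R" and normal: "\<And>i. i \<in> {1..d} \<Longrightarrow> normal_op (R i)"
    and J: "canonical_embedding d S R J"
  shows "cadjoint (R d) (R d x) = x"
proof -
  let ?M = "{k. cadjoint (R d) (R d k) = k}"
  have bS: "bounded_clinear (S d)" and bR: "\<And>i. i \<in> {1..d} \<Longrightarrow> bounded_clinear (R i)"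
    using S R d by (auto simp: contractive_hilbert_module_def commuting_tuple_def)
  have comm: "R i (R j x) = R j (R i x)" if "i \<in> {1..d}" "j \<in> {1..d}" for i j x
    using R that by (auto simp: contractive_hilbert_module_def commuting_tuple_def fun_eq_iff)
  have map: "module_map d S R J" and bJ: "bounded_clinear J"
    using J by (auto simp: canonical_embedding_def contractive_module_map_def module_map_def)
  have dd: "d \<in> {1..d}" using d by simp
  note bd = bR[OF dd] and nd = normal[OF dd]
  have bT: "bounded_clinear (\<lambda>k. cadjoint (R d) (R d k))"
    by (rule bounded_clinear_compose[OF bounded_clinear_cadjoint[OF bd] bd])
  have le: "norm (R d h) \<le> norm h" for h using norm_last_le[OF R d] .
  have le': "norm (cadjoint (R d) h) \<le> norm h" for h
    using norm_cadjoint_normal[OF bd nd] le by simp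
  have sym: "R d (cadjoint (R d) k) = cadjoint (R d) (R d k)" for k
    using nd by (simp add: normal_op_def fun_eq_iff)
  have "closed ?M"
    by (rule closed_Collect_eq[OF linear_continuous_on[OF bounded_clinearD(1)[OF bT]] continuous_on_id])
  then have "closed_csubspace ?M"
    unfolding closed_csubspace_def using bounded_clinearD(2,4,5)[OF bT] by auto
  moreover have "range J \<subseteq> ?M"
  proof safe
    fix h
    have lim: "(\<lambda>n. norm ((S d ^^ n) h)) \<longlonglongrightarrow> norm (J h)" for h
      using J by (intro canonical_norm_limit bS bJ) (simp add: canonical_embedding_def)
    \<comment> \<open>Both norms are limits of the same sequence, up to a shift of the index by
      one.\<close>
    have "(\<lambda>n. norm ((S d ^^ Suc n) h)) \<longlonglongrightarrow> norm (J (S d h))"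
      using lim[of "S d h"] by (simp add: funpow_swap1)
    then have "norm (J (S d h)) = norm (J h)"
      using LIMSEQ_Suc[OF lim[of h]] LIMSEQ_unique by blast
    then have "norm (J h) \<le> norm (R d (J h))"
      using module_map_intertwines[OF map dd, of h] by simp
    then show "cadjoint (R d) (R d (J h)) = J h"
      by (intro contraction_isometric_at bd le)
  qed
  moreover have "reduces d R ?M"
    unfolding reduces_def
  proof (intro ballI conjI image_subsetI CollectI; elim CollectE)
    fix i k assume i: "i \<in> {1..d}" and k: "cadjoint (R d) (R d k) = k"
    show "cadjoint (R d) (R d (R i k)) = R i k"
      by (rule commuting_preserves_unitary_part[OF bd nd le bR[OF i] comm[OF i dd] k])
    \<comment> \<open>The same lemma for the normal contraction \<open>cadjoint (R d)\<close> and
      the commuting operator \<open>cadjoint (R i)\<close>; by normality both contractions have the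
      same unitary part.\<close>
    have "cadjoint (cadjoint (R d)) (cadjoint (R d) (cadjoint (R i) k)) = cadjoint (R i) k"
      by (rule commuting_preserves_unitary_part[OF bounded_clinear_cadjoint[OF bd]
            normal_op_cadjoint[OF bd nd] le' bounded_clinear_cadjoint[OF bR[OF i]]
            cadjoint_commute[OF bR[OF i] bd comm[OF i dd]]])
        (simp add: cadjoint_cadjoint[OF bd] sym k)
    then show "cadjoint (R d) (R d (cadjoint (R i) k)) = cadjoint (R i) k"
      by (simp add: cadjoint_cadjoint[OF bd] sym)
  qed
  ultimately have "?M = UNIV"
    using J unfolding canonical_embedding_def by blast
  then show ?thesis by blast
qed

theorem theorem4:
  fixes d :: nat
    and S :: "nat \<Rightarrow> 'h::chilbert_space \<Rightarrow> 'h"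
    and R :: "nat \<Rightarrow> 'k::chilbert_space \<Rightarrow> 'k"
    and J :: "'h \<Rightarrow> 'k"
    and X :: "'h \<Rightarrow> 'h"
  assumes "d \<ge> 2"
    and "contractive_hilbert_module d S"
    and "unitary_hilbert_module d R"
    and "canonical_embedding d S R J"
    and "X \<in> commutant d S"
  shows "\<exists>Y \<in> commutant d R. onorm Y \<le> onorm X \<and>
           contractively_embedded 1 (\<lambda>_. X) (\<lambda>_. Y) \<and>
           contractive_module_map 1 (\<lambda>_. X) (\<lambda>_. Y) J"
proof -

  \<comment> \<open>Relations between \<open>W\<close>, the tuple \<open>R\<close> and the
    embedding\<close>
  define W where "W = cadjoint (R d)"
  have d: "1 \<le> d" and dd: "d \<in> {1..d}" using assms(1) by auto
  have contr: "contractive_hilbert_module d R" and normal: "\<And>i. i \<in> {1..d} \<Longrightarrow> normal_op (R i)"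
    using assms(3) by (auto simp: unitary_hilbert_module_def)
  have bS: "\<And>i. i \<in> {1..d} \<Longrightarrow> bounded_clinear (S i)"
    and bR: "\<And>i. i \<in> {1..d} \<Longrightarrow> bounded_clinear (R i)"
    using assms(2) contr by (auto simp: contractive_hilbert_module_def commuting_tuple_def)
  have comm: "R i (R j x) = R j (R i x)" if "i \<in> {1..d}" "j \<in> {1..d}" for i j x
    using contr that by (auto simp: contractive_hilbert_module_def commuting_tuple_def fun_eq_iff)
  have map: "module_map d S R J" and bJ: "bounded_clinear J" and J1: "onorm J \<le> 1"
    using assms(4) by (auto simp: canonical_embedding_def contractive_module_map_def module_map_def)
  have JS: "J (S i h) = R i (J h)" if "i \<in> {1..d}" for i h
    using module_map_intertwines[OF map that] .
  have bX: "bounded_clinear X" and XS: "\<And>i h. i \<in> {1..d} \<Longrightarrow> X (S i h) = S i (X h)"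
    using assms(5) by (auto simp: commutant_def fun_eq_iff)
  have WR: "W (R d x) = x" for x
    unfolding W_def using canonical_embedding_last_unitary[OF d assms(2) contr normal assms(4)] .
  have RW: "R d (W x) = x" for x
    using WR normal[OF dd] by (simp add: W_def normal_op_def fun_eq_iff)
  have bW: "bounded_clinear W" unfolding W_def by (intro bounded_clinear_cadjoint bR dd)
  have refl: "cadjoint (R i) x = W (R (d - i) x)" if "1 \<le> i" "i < d" for i x
    using contractive_module_reflection[OF contr, of "d - i" x] WR that by (simp add: W_def)
  have normW: "norm (W x) = norm x" for x
  proof -
    have "norm (W x) = norm (R d x)"
      unfolding W_def by (intro norm_cadjoint_normal bR normal dd)
    then show ?thesis
      using norm_last_le[OF contr d, of x] norm_last_le[OF contr d, of "W x"] by (simp add: RW)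
  qed
  have WRi: "W (R i x) = R i (W x)" if "i \<in> {1..d}" for i x
    by (metis RW WR comm dd that)
  have powR: "(W ^^ n) (R i x) = R i ((W ^^ n) x)" if "i \<in> {1..d}" for n i x
    by (induction n) (simp_all add: WRi[OF that])
  have pow_add: "(W ^^ n) (x + y) = (W ^^ n) x + (W ^^ n) y" for n x y
    by (induction n) (simp_all add: bounded_clinearD[OF bW])
  have pow_sc: "(W ^^ n) (scaleC c x) = scaleC c ((W ^^ n) x)" for n c x
    by (induction n) (simp_all add: bounded_clinearD[OF bW])
  have norm_pow: "norm ((W ^^ n) x) = norm x" for n x
    by (induction n) (simp_all add: normW)
  \<comment> \<open>\<open>W\<close> undoes \<open>R d\<close>, which \<open>J\<close> intertwines
    with \<open>S d\<close>, so the exponent of \<open>W\<close> can be raised at will. The ranges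
    of \<open>(W ^^ n) \<circ> J\<close> therefore increase with \<open>n\<close>.\<close>
  have shift: "(W ^^ n) (J h) = (W ^^ (n + m)) (J ((S d ^^ m) h))" for n m h
    by (induction m) (simp_all add: JS[OF dd] powR[OF dd] WR)
  have Xpow: "X ((S d ^^ m) h) = (S d ^^ m) (X h)" for m h
    by (induction m) (simp_all add: XS[OF dd])
  have lim: "(\<lambda>n. norm ((S d ^^ n) h)) \<longlonglongrightarrow> norm (J h)" for h
    using assms(4) by (intro canonical_norm_limit bS dd bJ) (simp add: canonical_embedding_def)
  \<comment> \<open>The estimate for \<open>X\<close> on the vectors \<open>(S d ^^ n) h\<close>
    survives in the limit. It makes the relation \<open>G\<close> below single-valued, although
    \<open>n\<close> and \<open>h\<close> are not determined by a vector.\<close>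
  have boundX: "norm (J (X h)) \<le> onorm X * norm (J h)" for h
  proof (rule LIMSEQ_le)
    show "(\<lambda>n. onorm X * norm ((S d ^^ n) h)) \<longlonglongrightarrow> onorm X * norm (J h)"
      by (intro tendsto_intros lim)
    show "\<exists>N. \<forall>n\<ge>N. norm ((S d ^^ n) (X h)) \<le> onorm X * norm ((S d ^^ n) h)"
      using bounded_clinearD(7)[OF bX] by (simp flip: Xpow)
  qed (rule lim)

  \<comment> \<open>The graph of the lift on the union of the ranges\<close>
  define G where "G = {((W ^^ n) (J h), (W ^^ n) (J (X h))) | n h. True}"
  have GE: "\<exists>n h. u = (W ^^ n) (J h) \<and> v = (W ^^ n) (J (X h))" if "(u, v) \<in> G" for u v
    using that unfolding G_def by simp
  have Gadd: "(u + u', v + v') \<in> G" if uv: "(u, v) \<in> G" "(u', v') \<in> G" for u v u' v'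
  proof -
    obtain n h n' h' where *: "u = (W ^^ n) (J h)" "v = (W ^^ n) (J (X h))"
      "u' = (W ^^ n') (J h')" "v' = (W ^^ n') (J (X h'))"
      using GE[OF uv(1)] GE[OF uv(2)] by blast
    \<comment> \<open>Each vector is moved to the common exponent \<open>n + n'\<close> by the
      exponent of the other.\<close>
    let ?h = "(S d ^^ n') h + (S d ^^ n) h'"
    have "u + u' = (W ^^ (n + n')) (J ?h)" "v + v' = (W ^^ (n + n')) (J (X ?h))"
      unfolding * bounded_clinearD(2)[OF bX] bounded_clinearD(2)[OF bJ] pow_add Xpow
      using shift[of n _ n'] shift[of n' _ n] by (simp_all add: add.commute[of n' n])
    then show ?thesis by (auto simp: G_def)
  qed
  have Gsc: "(scaleC c u, scaleC c v) \<in> G" if uv: "(u, v) \<in> G" for c u v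
  proof -
    obtain n h where *: "u = (W ^^ n) (J h)" "v = (W ^^ n) (J (X h))"
      using GE[OF uv] by blast
    have "scaleC c u = (W ^^ n) (J (scaleC c h))" "scaleC c v = (W ^^ n) (J (X (scaleC c h)))"
      by (simp_all add: * bounded_clinearD[OF bX] bounded_clinearD[OF bJ] pow_sc)
    then show ?thesis by (auto simp: G_def)
  qed
  have GJ: "(J h, J (X h)) \<in> G" for h
    unfolding G_def by (intro CollectI exI[of _ 0] exI[of _ h]) simp
  have G0: "(0, 0) \<in> G"
    using GJ[of 0] by (simp add: bounded_clinearD[OF bX] bounded_clinearD[OF bJ])
  have GR: "(R i u, R i v) \<in> G" if i: "i \<in> {1..d}" and uv: "(u, v) \<in> G" for i u v
  proof -
    obtain n h where "u = (W ^^ n) (J h)" "v = (W ^^ n) (J (X h))"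
      using GE[OF uv] by blast
    then have "R i u = (W ^^ n) (J (S i h))" "R i v = (W ^^ n) (J (X (S i h)))"
      by (simp_all add: JS[OF i] XS[OF i] powR[OF i])
    then show ?thesis by (auto simp: G_def)
  qed
  have GW: "(W u, W v) \<in> G" if uv: "(u, v) \<in> G" for u v
  proof -
    obtain n h where "u = (W ^^ n) (J h)" "v = (W ^^ n) (J (X h))"
      using GE[OF uv] by blast
    then have "W u = (W ^^ Suc n) (J h)" "W v = (W ^^ Suc n) (J (X h))" by simp_all
    then show ?thesis unfolding G_def by blast
  qed

  \<comment> \<open>Density of the domain by minimality\<close>
  let ?E = "fst ` G"
  have cl: "T ` closure ?E \<subseteq> closure ?E"
    if "bounded_clinear T" "\<And>u v. (u, v) \<in> G \<Longrightarrow> T u \<in> ?E" for T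
  proof -
    have "T ` closure ?E \<subseteq> closure (T ` ?E)"
      by (intro closure_bounded_linear_image_subset bounded_clinearD that)
    also have "\<dots> \<subseteq> closure ?E" using that(2) by (intro closure_mono) auto
    finally show ?thesis .
  qed
  have "closed_csubspace (closure ?E)"
  proof -
    have "bounded_clinear (scaleC c :: 'k \<Rightarrow> 'k)" for c
      by (simp add: bounded_clinear_def bounded_linear_scaleC scaleC_scaleC mult.commute)
    then have "scaleC c ` closure ?E \<subseteq> closure ?E" for c
      using Gsc by (intro cl) force+
    moreover have "x + y \<in> closure ?E" if "x \<in> closure ?E" "y \<in> closure ?E" for x y
      using closure_add_closed[OF _ that] Gadd by force
    moreover have "0 \<in> closure ?E" using G0 closure_subset[of ?E] by force
    ultimately show ?thesis by (auto simp: closed_csubspace_def)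
  qed
  moreover have "range J \<subseteq> closure ?E"
    using GJ closure_subset[of ?E] by force
  moreover have "reduces d R (closure ?E)"
    unfolding reduces_def
  proof (intro ballI conjI cl bounded_clinear_cadjoint bR)
    fix i u v assume i: "i \<in> {1..d}" and uv: "(u, v) \<in> G"
    show "R i u \<in> ?E" using GR[OF i uv] by force
    \<comment> \<open>The adjoint is \<open>W\<close> for \<open>i = d\<close> and \<open>W\<close>
      after \<open>R (d - i)\<close> otherwise, and \<open>G\<close> is invariant under both
      factors.\<close>
    have "(cadjoint (R i) u, cadjoint (R i) v) \<in> G"
    proof (cases "i = d")
      case True
      then show ?thesis using GW[OF uv] by (simp add: W_def)
    next
      case False
      then show ?thesis using i refl GW[OF GR[OF _ uv, of "d - i"]] by auto
    qed
    then show "cadjoint (R i) u \<in> ?E" by force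
  qed
  ultimately have dense: "closure ?E = UNIV"
    using assms(4) unfolding canonical_embedding_def by blast
  have "norm v \<le> onorm X * norm u" if "(u, v) \<in> G" for u v
    using that boundX by (auto simp: G_def norm_pow)
  then obtain Y where bY: "bounded_clinear Y" and Yle: "\<And>u. norm (Y u) \<le> onorm X * norm u"
    and YG: "\<And>u v. (u, v) \<in> G \<Longrightarrow> Y u = v"
    using bounded_extension_of_dense_graph[OF G0 Gadd Gsc _ dense] by blast

  \<comment> \<open>The lift commutes with the tuple and extends \<open>X\<close> along
    \<open>J\<close>\<close>
  have "Y (R i x) = R i (Y x)" if i: "i \<in> {1..d}" for i x
  proof -
    have "closed {x. Y (R i x) = R i (Y x)}"
      by (intro closed_Collect_eq linear_continuous_on bounded_clinearD(1)
          bounded_clinear_compose[OF bY bR[OF i]] bounded_clinear_compose[OF bR[OF i] bY])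
    moreover have "?E \<subseteq> {x. Y (R i x) = R i (Y x)}"
      using YG GR[OF i] by force
    ultimately have "closure ?E \<subseteq> {x. Y (R i x) = R i (Y x)}" by (rule closure_minimal[rotated])
    then show ?thesis using dense by blast
  qed
  then have "Y \<in> commutant d R" using bY by (auto simp: commutant_def)
  moreover have "onorm Y \<le> onorm X"
    by (intro onorm_bound Yle onorm_pos_le bounded_clinearD(1) bX)
  \<comment> \<open>The pairs in \<open>G\<close> with exponent 0 say that \<open>Y\<close>
    intertwines with \<open>X\<close> along \<open>J\<close>, so \<open>J\<close> itself is the
    embedding.\<close>
  moreover have "contractive_module_map 1 (\<lambda>_. X) (\<lambda>_. Y) J"
    unfolding contractive_module_map_def
    using single_operator_module_mapI[OF bJ, of X Y] YG[OF GJ] J1 by simp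
  ultimately show ?thesis by (auto simp: contractively_embedded_def)
qed

end
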